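(* Let $d\geqslant 3$ and let $V$ be a non-negative potential on $\mathbb{R}^d$ which is compactly supported and not identically equal to zero (as an element of $L^q$). Assume that $V\in L^q(\mathbb{R}^d)$ with $q>d/2$ and $q\geqslant 2$. Then for any $a>0$ we have $R_V^a(\mathbf 1)(x)=\infty$ for $x$ such that $V(x)\neq 0$. In particular, $R_V^a$ is unbounded on $L^\infty(\mathbb{R}^d)$.
   Context: Let $L=-\frac12\Delta+V$. For $t>0$ and $f\in L^\infty$ (in particular for the constant function $\mathbf 1$) define $e^{-tL}f(x)=\mathbb{E}_x\big[e^{-\int_0^tV(X_s)\,ds}f(X_t)\big]$, where $\mathbb{E}_x$ is expectation for the standard $d$-dimensional Brownian motion $\{X_s\}$ (generator $\frac12\Delta$) started at $x$. For $a>0$ put $$R_V^a(\mathbf 1)(x)=V^a(x)\cdot\frac1{\Gamma(a)}\int_0^\infty e^{-tL}(\mathbf 1)(x)\,t^{a-1}\,dt\in[0,\infty].$$ $R_V^a$ is said to be bounded on $L^\infty$ if $\|R_V^a(\mathbf 1)\|_\infty<\infty$, and unbounded otherwise. $V(x)$ denotes the value at $x$ of a fixed representative of $V$. *)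

theory Defs
  imports "HOL-Probability.Probability"
begin

text \<open>
  A standard Brownian motion in \<open>\<real>\<^sup>n\<close>, started at \<open>x\<close>, on the probability space \<open>M\<close>. Only times
  \<open>t \<ge> 0\<close> are constrained. The increment over \<open>[s, t]\<close> is centred Gaussian with covariance
  \<open>(t - s) I\<close>, so that the generator is half the Laplacian.
\<close>

locale brownian_motion = prob_space M
  for M :: "'w measure" and X :: "real \<Rightarrow> 'w \<Rightarrow> real ^ 'n" and x :: "real ^ 'n" +
  assumes random_variable_at: "0 \<le> t \<Longrightarrow> X t \<in> borel_measurable M"
    and starts_at: "AE \<omega> in M. X 0 \<omega> = x"
    and independent_increments:
      "\<lbrakk>0 \<le> \<tau> 0; \<And>i. i < k \<Longrightarrow> \<tau> i < \<tau> (Suc i)\<rbrakk>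
        \<Longrightarrow> indep_vars (\<lambda>_. borel) (\<lambda>i \<omega>. X (\<tau> (Suc i)) \<omega> - X (\<tau> i) \<omega>) {..<(k::nat)}"
    and gaussian_increments:
      "\<lbrakk>0 \<le> s; s < t\<rbrakk>
        \<Longrightarrow> distributed M lborel (\<lambda>\<omega>. X t \<omega> - X s \<omega>)
              (\<lambda>y. ennreal (\<Prod>i\<in>UNIV. normal_density 0 (sqrt (t - s)) (y $ i)))"
    and continuous_paths: "AE \<omega> in M. continuous_on {0..} (\<lambda>t. X t \<omega>)"

definition mem_Lq :: "real \<Rightarrow> (real ^ 'n \<Rightarrow> real) \<Rightarrow> bool" where
  "mem_Lq q f \<longleftrightarrow> f \<in> borel_measurable lebesgue \<and> integrable lebesgue (\<lambda>x. \<bar>f x\<bar> powr q)"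

text \<open>\<open>e\<^sup>-\<^sup>z\<close> for \<open>z \<in> [0, \<infinity>]\<close>, with \<open>e\<^sup>-\<^sup>\<infinity> = 0\<close>.\<close>

definition exp_neg :: "ennreal \<Rightarrow> real" where
  "exp_neg z = (if z = \<infinity> then 0 else exp (- enn2real z))"

text \<open>
  The Feynman--Kac semigroup generated by \<open>- L\<close>, where \<open>L = - \<Delta>/2 + V\<close> with \<open>V \<ge> 0\<close>. The family
  \<open>(M x, X x)\<close> supplies a Brownian motion for each starting point \<open>x\<close>. The potential is
  only Lebesgue measurable, so the path functional need only agree almost surely with a random
  variable on \<open>M x\<close>; this is why the expectation is taken over the completion of \<open>M x\<close>. The time
  integral of \<open>V\<close> along a path is taken in \<open>[0, \<infinity>]\<close>.
\<close>

definition semigroup ::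
    "(real ^ 'n \<Rightarrow> 'w measure) \<Rightarrow> (real ^ 'n \<Rightarrow> real \<Rightarrow> 'w \<Rightarrow> real ^ 'n) \<Rightarrow> (real ^ 'n \<Rightarrow> real)
      \<Rightarrow> real \<Rightarrow> (real ^ 'n \<Rightarrow> real) \<Rightarrow> real ^ 'n \<Rightarrow> real" where
  "semigroup M X V t f x =
    (\<integral>\<omega>. exp_neg (\<integral>\<^sup>+s\<in>{0..t}. ennreal (V (X x s \<omega>)) \<partial>lebesgue) * f (X x t \<omega>) \<partial>completion (M x))"

definition riesz_one ::
    "(real ^ 'n \<Rightarrow> 'w measure) \<Rightarrow> (real ^ 'n \<Rightarrow> real \<Rightarrow> 'w \<Rightarrow> real ^ 'n) \<Rightarrow> (real ^ 'n \<Rightarrow> real)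
      \<Rightarrow> real \<Rightarrow> real ^ 'n \<Rightarrow> ennreal" where
  "riesz_one M X V a x =
    ennreal (V x powr a) *
      (ennreal (1 / Gamma a) *
        (\<integral>\<^sup>+t\<in>{0<..}. ennreal (semigroup M X V t (\<lambda>_. 1) x * t powr (a - 1)) \<partial>lebesgue))"

text \<open>
  The \<open>L\<^sup>\<infinity>\<close> norm of a \<open>[0, \<infinity>]\<close>-valued function. In contrast to \<^const>\<open>esssup\<close>, it is not set to
  \<open>\<infinity>\<close> by convention on non-measurable functions; on measurable ones the two agree.
\<close>

definition Linf_norm :: "(real ^ 'n \<Rightarrow> ennreal) \<Rightarrow> ennreal" where
  "Linf_norm g = Inf {C. AE x in lebesgue. g x \<le> C}"

lemma Linf_norm_eq_esssup:
  "g \<in> borel_measurable lebesgue \<Longrightarrow> Linf_norm g = esssup lebesgue g"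
  by (simp add: Linf_norm_def esssup_eq_AE)

definition riesz_bounded_on_Linf ::
    "(real ^ 'n \<Rightarrow> 'w measure) \<Rightarrow> (real ^ 'n \<Rightarrow> real \<Rightarrow> 'w \<Rightarrow> real ^ 'n) \<Rightarrow> (real ^ 'n \<Rightarrow> real)
      \<Rightarrow> real \<Rightarrow> bool" where
  "riesz_bounded_on_Linf M X V a \<longleftrightarrow> Linf_norm (riesz_one M X V a) < \<infinity>"

end

theory Submission
  imports Defs
begin

text \<open>
  The potential is too weak, seen from any starting point \<open>x\<close>, to make \<open>e\<^sup>-\<^sup>t\<^sup>L 1(x)\<close> tend to \<open>0\<close>.
  The expected total amount of potential collected by a path,
  \<open>C = E\<^sub>x \<integral>\<^sub>0\<^sup>\<infinity> V(X\<^sub>s) ds\<close>, is finite: up to time \<open>1\<close> because \<open>V \<in> L\<^sup>q\<close> with \<open>q > d / 2\<close>, after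
  time \<open>1\<close> because \<open>V \<in> L\<^sup>1\<close> and Brownian motion is transient for \<open>d \<ge> 3\<close>
  (\<open>expected_occupation_finite\<close>). Jensen's inequality (\<open>exp_neg_Jensen\<close>) then gives
  \<open>e\<^sup>-\<^sup>t\<^sup>L 1(x) \<ge> e\<^sup>-\<^sup>C > 0\<close> for every \<open>t\<close>, so the integral of \<open>e\<^sup>-\<^sup>t\<^sup>L 1(x) t\<^sup>a\<^sup>-\<^sup>1\<close> is bounded below by a multiple
  of the divergent integral of \<open>t\<^sup>a\<^sup>-\<^sup>1\<close> over \<open>(0, \<infinity>)\<close>. Where \<open>V(x) \<noteq> 0\<close> the factor
  \<open>V(x)\<^sup>a / \<Gamma>(a)\<close> is positive, so the product is infinite; and the set where
  \<open>V \<noteq> 0\<close> is not null, so the essential supremum is infinite too.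

  What remains is measurability. As \<open>V\<close> is only Lebesgue measurable, it is replaced by a Borel
  function \<open>W\<close> that agrees with it almost everywhere; almost every path spends zero time in the
  exceptional null set (\<open>AE_path_avoids_null_set\<close>), so the path functional does not change.
  Tonelli's theorem needs joint measurability in time and path, which path continuity provides after
  a modification on a null event (\<open>ex_jointly_measurable_version\<close>). The semigroup is a Bochner
  integral, which would be \<open>0\<close> for a non-measurable integrand; the integrand is measurable on the
  completed probability space since it agrees almost surely with a measurable one
  (\<open>exp_neg_additive_functional_ge\<close>).
\<close>

section \<open>Integrals of powers\<close>

lemma nn_integral_powr_0_1_finite:
  assumes "p < 1"
  shows "(\<integral>\<^sup>+s. ennreal (s powr (- p)) * indicator {0..1} s \<partial>lborel) < \<infinity>"
proof -
  have "((\<lambda>s. s powr (- p)) has_integral (1 powr (- p + 1) / (- p + 1))) {0..1::real}"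
    using assms by (intro has_integral_powr_from_0) auto
  from nn_integral_has_integral_lebesgue'[OF _ this] show ?thesis by simp
qed

lemma nn_integral_powr_1_inf_finite:
  assumes "1 < p"
  shows "(\<integral>\<^sup>+s. ennreal (s powr (- p)) * indicator {1::real..} s \<partial>lborel) < \<infinity>"
proof -
  have "((\<lambda>s. s powr (- p)) has_integral (- (1 powr (- p + 1)) / (- p + 1))) {1::real..}"
    using assms by (intro has_integral_powr_to_inf) auto
  from nn_integral_has_integral_lebesgue'[OF _ this] show ?thesis by simp
qed

lemma nn_integral_powr_diverges:
  fixes a :: real
  assumes "a > 0"
  shows "(\<integral>\<^sup>+t. ennreal (t powr (a - 1)) * indicator {0<..} t \<partial>lborel) = \<infinity>"
proof -
  let ?I = "\<integral>\<^sup>+t. ennreal (t powr (a - 1)) * indicator {0<..} t \<partial>lborel"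
  have lower: "ennreal (c powr a / a) \<le> ?I" if "c \<ge> 0" for c
  proof -
    have "((\<lambda>t. t powr (a - 1)) has_integral (c powr (a - 1 + 1) / (a - 1 + 1))) {0..c}"
      using assms that by (intro has_integral_powr_from_0) auto
    from nn_integral_has_integral_lebesgue'[OF _ this]
    have "ennreal (c powr a / a) = (\<integral>\<^sup>+t. ennreal (t powr (a - 1)) * indicator {0..c} t \<partial>lborel)"
      by simp
    also have "\<dots> \<le> ?I"
      by (intro nn_integral_mono) (auto simp: indicator_def)
    finally show ?thesis .
  qed
  show ?thesis
  proof (rule ccontr)
    assume "?I \<noteq> \<infinity>"
    then obtain r where r: "?I = ennreal r" "r \<ge> 0" by (cases ?I) auto
    \<comment> \<open>The upper limit at which the integral over \<open>[0, c]\<close> already equals \<open>r + 1\<close>.\<close>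
    define c where "c = (a * (r + 1)) powr (1 / a)"
    have "c powr a / a = r + 1"
      using assms r by (simp add: c_def powr_powr)
    then show False
      using lower[of c] r by (simp add: c_def ennreal_le_iff)
  qed
qed

section \<open>Joint measurability of continuous processes\<close>

lemma floor_grid_tendsto:
  fixes s :: real
  shows "(\<lambda>n. real_of_int \<lfloor>real (Suc n) * s\<rfloor> / real (Suc n)) \<longlonglongrightarrow> s"
proof (rule real_tendsto_sandwich)
  show "\<forall>\<^sub>F n in sequentially. s - inverse (real (Suc n)) \<le> real_of_int \<lfloor>real (Suc n) * s\<rfloor> / real (Suc n)"
  proof (intro always_eventually allI)
    fix n
    have "real (Suc n) * s - 1 \<le> real_of_int \<lfloor>real (Suc n) * s\<rfloor>" by linarith
    then have "(real (Suc n) * s - 1) / real (Suc n) \<le> real_of_int \<lfloor>real (Suc n) * s\<rfloor> / real (Suc n)"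
      by (rule divide_right_mono) simp
    then show "s - inverse (real (Suc n)) \<le> real_of_int \<lfloor>real (Suc n) * s\<rfloor> / real (Suc n)"
      by (simp add: diff_divide_distrib inverse_eq_divide del: of_nat_Suc)
  qed
  show "\<forall>\<^sub>F n in sequentially. real_of_int \<lfloor>real (Suc n) * s\<rfloor> / real (Suc n) \<le> s"
  proof (intro always_eventually allI)
    fix n
    have "real_of_int \<lfloor>real (Suc n) * s\<rfloor> \<le> real (Suc n) * s" by linarith
    then show "real_of_int \<lfloor>real (Suc n) * s\<rfloor> / real (Suc n) \<le> s"
      by (simp add: pos_divide_le_eq mult.commute del: of_nat_Suc)
  qed
  show "(\<lambda>n. s - inverse (real (Suc n))) \<longlonglongrightarrow> s"
    using tendsto_diff[OF tendsto_const LIMSEQ_inverse_real_of_nat, of s] by simp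
qed simp

text \<open>A continuous process is the pointwise limit of its samplings along finer and finer time
  grids, each of which involves only countably many random variables.\<close>

lemma continuous_process_jointly_measurable:
  fixes Y :: "real \<Rightarrow> 'w \<Rightarrow> 'b :: metric_space"
  assumes meas[measurable]: "\<And>s. Y s \<in> borel_measurable M"
    and cont: "\<And>\<omega>. \<omega> \<in> space M \<Longrightarrow> continuous_on UNIV (\<lambda>s. Y s \<omega>)"
  shows "(\<lambda>(s, \<omega>). Y s \<omega>) \<in> borel_measurable (lborel \<Otimes>\<^sub>M M)"
proof (rule borel_measurable_LIMSEQ_metric)
  fix n :: nat
  have "(\<lambda>p. Y (real_of_int \<lfloor>real (Suc n) * fst p\<rfloor> / real (Suc n)) (snd p))
          \<in> borel_measurable (lborel \<Otimes>\<^sub>M M)"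
    by (rule measurable_compose_countable[where f = "\<lambda>i p. Y (real_of_int i / real (Suc n)) (snd p)"
          and g = "\<lambda>p. \<lfloor>real (Suc n) * fst p\<rfloor>"]) measurable
  then show "(\<lambda>(s, \<omega>). Y (real_of_int \<lfloor>real (Suc n) * s\<rfloor> / real (Suc n)) \<omega>)
          \<in> borel_measurable (lborel \<Otimes>\<^sub>M M)"
    by (simp add: case_prod_beta)
next
  fix p :: "real \<times> 'w" assume "p \<in> space (lborel \<Otimes>\<^sub>M M)"
  then have "snd p \<in> space M" by (auto simp: space_pair_measure)
  then have "isCont (\<lambda>s. Y s (snd p)) (fst p)"
    using cont by (simp add: continuous_on_eq_continuous_at)
  from isCont_tendsto_compose[OF this floor_grid_tendsto]
  show "(\<lambda>n. case p of (s, \<omega>) \<Rightarrow> Y (real_of_int \<lfloor>real (Suc n) * s\<rfloor> / real (Suc n)) \<omega>)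
          \<longlonglongrightarrow> (case p of (s, \<omega>) \<Rightarrow> Y s \<omega>)"
    by (simp add: case_prod_beta)
qed

lemma borel_measurable_completion_cong_AE:
  fixes f g :: "'a \<Rightarrow> 'b :: topological_space"
  assumes f: "f \<in> borel_measurable M" and fg: "AE x in M. f x = g x"
  shows "g \<in> borel_measurable (completion M)"
proof (rule measurableI)
  fix A :: "'b set" assume A: "A \<in> sets borel"
  show "g -` A \<inter> space (completion M) \<in> sets (completion M)"
  proof (rule completion.in_sets_AE)
    show "AE x in completion M. x \<in> f -` A \<inter> space M \<longleftrightarrow> x \<in> g -` A \<inter> space (completion M)"
      using AE_completion[OF fg] by eventually_elim simp
    show "f -` A \<inter> space M \<in> sets (completion M)"
      using measurable_sets[OF f A] by simp
  qed simp
qed simp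

section \<open>Jensen's inequality for the path functional\<close>

lemma exp_neg_measurable [measurable]: "exp_neg \<in> borel_measurable borel"
  unfolding exp_neg_def[abs_def] by measurable

lemma exp_neg_nonneg: "0 \<le> exp_neg z"
  and exp_neg_le_1: "exp_neg z \<le> 1"
  by (auto simp: exp_neg_def)

lemma (in prob_space) exp_neg_Jensen:
  fixes Z :: "'a \<Rightarrow> ennreal" and C :: real
  assumes Z[measurable]: "Z \<in> borel_measurable M"
    and C: "(\<integral>\<^sup>+\<omega>. Z \<omega> \<partial>M) \<le> ennreal C" "C \<ge> 0"
  shows "exp (- C) \<le> (\<integral>\<omega>. exp_neg (Z \<omega>) \<partial>M)"
proof -
  have "(\<integral>\<^sup>+\<omega>. Z \<omega> \<partial>M) < \<infinity>"
    using C by (simp add: le_less_trans)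
  then have finite: "AE \<omega> in M. Z \<omega> \<noteq> \<infinity>"
    by (intro nn_integral_PInf_AE) auto
  then have nn: "(\<integral>\<^sup>+\<omega>. ennreal (enn2real (Z \<omega>)) \<partial>M) = (\<integral>\<^sup>+\<omega>. Z \<omega> \<partial>M)"
    by (intro nn_integral_cong_AE) (auto simp: less_top)
  then have int: "integrable M (\<lambda>\<omega>. enn2real (Z \<omega>))"
    using C by (intro integrableI_nonneg) (auto simp: le_less_trans)
  have "ennreal (\<integral>\<omega>. enn2real (Z \<omega>) \<partial>M) \<le> ennreal C"
    using nn_integral_eq_integral[OF int] nn C by simp
  then have mean: "(\<integral>\<omega>. enn2real (Z \<omega>) \<partial>M) \<le> C"
    using C by (simp add: ennreal_le_iff)
  have "exp (- C) \<le> exp (- C) * (1 + C - (\<integral>\<omega>. enn2real (Z \<omega>) \<partial>M))"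
    using mean by simp
  also have "\<dots> = (\<integral>\<omega>. exp (- C) * (1 + C - enn2real (Z \<omega>)) \<partial>M)"
    using int by (simp add: prob_space)
  also have "\<dots> \<le> (\<integral>\<omega>. exp_neg (Z \<omega>) \<partial>M)"
  proof (rule integral_mono_AE)
    show "integrable M (\<lambda>\<omega>. exp (- C) * (1 + C - enn2real (Z \<omega>)))"
      using int by simp
    show "integrable M (\<lambda>\<omega>. exp_neg (Z \<omega>))"
      by (rule integrable_const_bound[where B = 1]) (auto simp: exp_neg_nonneg exp_neg_le_1)
    show "AE \<omega> in M. exp (- C) * (1 + C - enn2real (Z \<omega>)) \<le> exp_neg (Z \<omega>)"
      using finite
    proof eventually_elim
      case (elim \<omega>)
      \<comment> \<open>The tangent to \<open>exp (- z)\<close> at \<open>z = C\<close> lies below the graph.\<close>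
      have "exp (- C) * (1 + (C - enn2real (Z \<omega>))) \<le> exp (- C) * exp (C - enn2real (Z \<omega>))"
        by (intro mult_left_mono exp_ge_add_one_self) simp
      also have "\<dots> = exp (- enn2real (Z \<omega>))"
        by (simp flip: exp_add)
      finally show ?case using elim by (simp add: exp_neg_def add_diff_eq)
    qed
  qed
  finally show ?thesis .
qed

section \<open>Occupation times of Brownian motion\<close>

definition gauss_density :: "real \<Rightarrow> real ^ 'n \<Rightarrow> real" where
  "gauss_density t y = (\<Prod>i\<in>UNIV. normal_density 0 (sqrt t) (y $ i))"

lemma gauss_density_nonneg: "0 \<le> gauss_density t y"
  unfolding gauss_density_def by (intro prod_nonneg) auto

lemma gauss_density_measurable [measurable]: "gauss_density t \<in> borel_measurable borel"
  unfolding gauss_density_def[abs_def] by measurable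

lemma gauss_density_le:
  fixes y :: "real ^ 'n"
  assumes "t > 0"
  shows "gauss_density t y \<le> t powr (- (real CARD('n) / 2))"
proof -
  have "normal_density 0 (sqrt t) z \<le> t powr (- (1 / 2))" for z
  proof -
    have "t * 1 \<le> t * (2 * pi)"
      using assms pi_gt3 by (intro mult_left_mono) auto
    then have "1 / sqrt (2 * pi * t) \<le> 1 / sqrt t"
      using assms by (intro divide_left_mono real_sqrt_le_mono) (auto simp: mult_ac)
    then have "1 / sqrt (2 * pi * t) * exp (- z\<^sup>2 / (2 * t)) \<le> 1 / sqrt t * 1"
      using assms by (intro mult_mono) auto
    then show ?thesis
      using assms by (simp add: normal_density_def powr_minus_divide powr_half_sqrt)
  qed
  then have "gauss_density t y \<le> (\<Prod>i\<in>(UNIV :: 'n set). t powr (- (1 / 2)))"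
    unfolding gauss_density_def by (intro prod_mono) auto
  also have "\<dots> = t powr (- (real CARD('n) / 2))"
    using assms by (simp add: powr_powr flip: powr_realpow)
  finally show ?thesis .
qed

context brownian_motion
begin

lemma nn_integral_position:
  assumes t: "t > 0" and f[measurable]: "f \<in> borel_measurable borel"
  shows "(\<integral>\<^sup>+\<omega>. f (X t \<omega>) \<partial>M) = (\<integral>\<^sup>+y. ennreal (gauss_density t y) * f (x + y) \<partial>lborel)"
proof -
  have D: "distributed M lborel (\<lambda>\<omega>. X t \<omega> - X 0 \<omega>) (\<lambda>y. ennreal (gauss_density t y))"
    using gaussian_increments[of 0 t] t by (simp add: gauss_density_def)
  have "(\<integral>\<^sup>+\<omega>. f (X t \<omega>) \<partial>M) = (\<integral>\<^sup>+\<omega>. f (x + (X t \<omega> - X 0 \<omega>)) \<partial>M)"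
    by (rule nn_integral_cong_AE) (use starts_at in eventually_elim, simp)
  also have "\<dots> = (\<integral>\<^sup>+y. ennreal (gauss_density t y) * f (x + y) \<partial>lborel)"
    by (rule distributed_nn_integral[OF D, symmetric]) simp
  finally show ?thesis .
qed

lemma nn_integral_position_le:
  assumes t: "t > 0" and f[measurable]: "f \<in> borel_measurable borel"
  shows "(\<integral>\<^sup>+\<omega>. f (X t \<omega>) \<partial>M) \<le> ennreal (t powr (- (real CARD('n) / 2))) * (\<integral>\<^sup>+y. f y \<partial>lborel)"
proof -
  have "(\<integral>\<^sup>+\<omega>. f (X t \<omega>) \<partial>M)
      \<le> (\<integral>\<^sup>+y. ennreal (t powr (- (real CARD('n) / 2))) * f (x + y) \<partial>lborel)"
    unfolding nn_integral_position[OF assms]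
    by (intro nn_integral_mono mult_right_mono ennreal_leI gauss_density_le t) simp
  also have "\<dots> = ennreal (t powr (- (real CARD('n) / 2))) * (\<integral>\<^sup>+y. f (x + y) \<partial>lborel)"
    by (rule nn_integral_cmult) simp
  also have "(\<integral>\<^sup>+y. f (x + y) \<partial>lborel) = (\<integral>\<^sup>+y. f y \<partial>distr lborel borel ((+) x))"
    by (simp add: nn_integral_distr)
  finally show ?thesis by (simp add: lborel_distr_plus)
qed

text \<open>This is Hoelder's inequality between \<open>W \<in> L\<^sup>q\<close> and the heat kernel, obtained by
  interpolating between the total mass and the supremum of the kernel.
  The truncation level in \<open>W \<le> l + l\<^sup>1\<^sup>-\<^sup>q W\<^sup>q\<close> is chosen as \<open>l = t powr (- d / (2 q))\<close>,
  which makes both terms of the same order in \<open>t\<close>.\<close>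

lemma nn_integral_position_le_Lq:
  fixes W :: "real ^ 'n \<Rightarrow> real"
  assumes t: "t > 0" and W[measurable]: "W \<in> borel_measurable borel"
    and W0: "\<And>y. 0 \<le> W y" and q: "q \<ge> 1"
  shows "(\<integral>\<^sup>+\<omega>. ennreal (W (X t \<omega>)) \<partial>M)
    \<le> ennreal (t powr (- (real CARD('n) / (2 * q)))) * (1 + (\<integral>\<^sup>+y. ennreal (W y powr q) \<partial>lborel))"
proof -
  let ?d = "real CARD('n)" and ?K = "\<integral>\<^sup>+y. ennreal (W y powr q) \<partial>lborel"
  have [measurable]: "X t \<in> borel_measurable M"
    using random_variable_at t by simp
  define l where "l = t powr (- (?d / (2 * q)))"
  have l: "l > 0" using t by (simp add: l_def)
  have split: "v \<le> l + l powr (1 - q) * v powr q" if "v \<ge> 0" for v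
  proof (cases "v \<le> l")
    case True
    then show ?thesis by (simp add: add_increasing2)
  next
    case False
    then have "v powr (1 - q) \<le> l powr (1 - q)"
      using l q by (intro powr_mono2') auto
    then have "v powr (1 - q) * v powr q \<le> l powr (1 - q) * v powr q"
      by (rule mult_right_mono) simp
    moreover have "v powr (1 - q) * v powr q = v"
      using False l by (simp flip: powr_add)
    ultimately show ?thesis using l by simp
  qed
  have exponent: "l powr (1 - q) * t powr (- (?d / 2)) = l"
  proof -
    have "- (?d / (2 * q)) * (1 - q) + - (?d / 2) = - (?d / (2 * q))"
      using q by (simp add: field_simps)
    then show ?thesis
      unfolding l_def by (simp add: powr_powr flip: powr_add)
  qed
  have "(\<integral>\<^sup>+\<omega>. ennreal (W (X t \<omega>)) \<partial>M)
      \<le> (\<integral>\<^sup>+\<omega>. ennreal l + ennreal (l powr (1 - q)) * ennreal (W (X t \<omega>) powr q) \<partial>M)"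
  proof (rule nn_integral_mono)
    fix \<omega>
    have "ennreal (W (X t \<omega>)) \<le> ennreal (l + l powr (1 - q) * W (X t \<omega>) powr q)"
      by (intro ennreal_leI split W0)
    then show "ennreal (W (X t \<omega>)) \<le> ennreal l + ennreal (l powr (1 - q)) * ennreal (W (X t \<omega>) powr q)"
      using l by (simp add: ennreal_mult)
  qed
  also have "\<dots> = ennreal l + ennreal (l powr (1 - q)) * (\<integral>\<^sup>+\<omega>. ennreal (W (X t \<omega>) powr q) \<partial>M)"
    by (simp add: nn_integral_add nn_integral_cmult emeasure_space_1)
  also have "\<dots> \<le> ennreal l + ennreal (l powr (1 - q)) * (ennreal (t powr (- (?d / 2))) * ?K)"
    using nn_integral_position_le[OF t, of "\<lambda>y. ennreal (W y powr q)"]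
    by (intro add_left_mono mult_left_mono) auto
  also have "\<dots> = ennreal l * (1 + ?K)"
    using exponent by (simp add: distrib_left flip: mult.assoc ennreal_mult)
  finally show ?thesis by (simp add: l_def)
qed

text \<open>Small times are integrable because \<open>q > d / 2\<close>; large times are integrable because Brownian
  motion is transient: its density decays like \<open>s powr (- d / 2)\<close> with \<open>d / 2 > 1\<close>.\<close>

lemma expected_occupation_finite:
  fixes W :: "real ^ 'n \<Rightarrow> real"
  assumes dim: "CARD('n) \<ge> 3" and W[measurable]: "W \<in> borel_measurable borel"
    and W0: "\<And>y. 0 \<le> W y" and q: "q > real CARD('n) / 2"
    and L1: "(\<integral>\<^sup>+y. ennreal (W y) \<partial>lborel) < \<infinity>"
    and Lq: "(\<integral>\<^sup>+y. ennreal (W y powr q) \<partial>lborel) < \<infinity>"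
  shows "(\<integral>\<^sup>+s. (\<integral>\<^sup>+\<omega>. ennreal (W (X s \<omega>)) \<partial>M) * indicator {0..} s \<partial>lborel) < \<infinity>"
proof -
  let ?d = "real CARD('n)"
  define I where "I = (\<integral>\<^sup>+y. ennreal (W y) \<partial>lborel)"
  define K where "K = (\<integral>\<^sup>+y. ennreal (W y powr q) \<partial>lborel)"
  have q1: "q \<ge> 1" using q dim by linarith
  have "(\<integral>\<^sup>+s. (\<integral>\<^sup>+\<omega>. ennreal (W (X s \<omega>)) \<partial>M) * indicator {0..} s \<partial>lborel)
     \<le> (\<integral>\<^sup>+s. (1 + K) * (ennreal (s powr (- (?d / (2 * q)))) * indicator {0..1} s)
           + I * (ennreal (s powr (- (?d / 2))) * indicator {1..} s) \<partial>lborel)"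
  proof (rule nn_integral_mono_AE)
    show "AE s in lborel. (\<integral>\<^sup>+\<omega>. ennreal (W (X s \<omega>)) \<partial>M) * indicator {0..} s
       \<le> (1 + K) * (ennreal (s powr (- (?d / (2 * q)))) * indicator {0..1} s)
           + I * (ennreal (s powr (- (?d / 2))) * indicator {1..} s)"
      using AE_lborel_singleton[of "0 :: real"]
    proof eventually_elim
      case (elim s)
      consider "s < 0" | "0 < s" "s \<le> 1" | "1 < s" using elim by linarith
      then show ?case
      proof cases
        case 1
        then show ?thesis by simp
      next
        case 2
        have "(\<integral>\<^sup>+\<omega>. ennreal (W (X s \<omega>)) \<partial>M) \<le> (1 + K) * ennreal (s powr (- (?d / (2 * q))))"
          using nn_integral_position_le_Lq[OF \<open>0 < s\<close> W W0 q1] by (simp add: K_def mult.commute)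
        then show ?thesis
          using 2 by (simp add: add_increasing2)
      next
        case 3
        have "(\<integral>\<^sup>+\<omega>. ennreal (W (X s \<omega>)) \<partial>M) \<le> I * ennreal (s powr (- (?d / 2)))"
          using nn_integral_position_le[of s "\<lambda>y. ennreal (W y)"] 3 by (simp add: I_def mult.commute)
        then show ?thesis
          using 3 by simp
      qed
    qed
  qed
  also have "\<dots> = (1 + K) * (\<integral>\<^sup>+s. ennreal (s powr (- (?d / (2 * q)))) * indicator {0..1} s \<partial>lborel)
           + I * (\<integral>\<^sup>+s. ennreal (s powr (- (?d / 2))) * indicator {1..} s \<partial>lborel)"
    by (simp add: nn_integral_add nn_integral_cmult)
  also have "\<dots> < \<infinity>"
  proof -
    have "?d / (2 * q) < 1" using q q1 by (simp add: field_simps)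
    note A = nn_integral_powr_0_1_finite[OF this]
    have "1 < ?d / 2" using dim by simp
    note B = nn_integral_powr_1_inf_finite[OF this]
    show ?thesis
      using A B L1 Lq by (simp add: ennreal_mult_less_top I_def K_def)
  qed
  finally show ?thesis .
qed

lemma ex_jointly_measurable_version:
  "\<exists>Y :: real \<Rightarrow> 'w \<Rightarrow> real ^ 'n. (\<lambda>(s, \<omega>). Y s \<omega>) \<in> borel_measurable (lborel \<Otimes>\<^sub>M M)
     \<and> (AE \<omega> in M. \<forall>s\<ge>0. Y s \<omega> = X s \<omega>)"
proof -
  from continuous_paths obtain N where
    N: "N \<in> null_sets M" "{\<omega> \<in> space M. \<not> continuous_on {0..} (\<lambda>t. X t \<omega>)} \<subseteq> N"
    by (auto simp: eventually_ae_filter)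
  have [measurable]: "N \<in> sets M" using N by auto
  define Y where "Y s \<omega> = (if \<omega> \<in> N then x else X (max 0 s) \<omega>)" for s \<omega>
  have "(\<lambda>(s, \<omega>). Y s \<omega>) \<in> borel_measurable (lborel \<Otimes>\<^sub>M M)"
  proof (rule continuous_process_jointly_measurable)
    fix s
    have [measurable]: "X (max 0 s) \<in> borel_measurable M"
      by (rule random_variable_at) simp
    show "Y s \<in> borel_measurable M"
      unfolding Y_def[abs_def] by measurable
  next
    fix \<omega> assume "\<omega> \<in> space M"
    show "continuous_on UNIV (\<lambda>s. Y s \<omega>)"
    proof (cases "\<omega> \<in> N")
      case True
      then show ?thesis by (simp add: Y_def)
    next
      case False
      then have "continuous_on {0..} (\<lambda>t. X t \<omega>)"
        using N \<open>\<omega> \<in> space M\<close> by auto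
      then have "continuous_on UNIV (\<lambda>s. X (max 0 s) \<omega>)"
        by (rule continuous_on_compose2[where g = "\<lambda>t. X t \<omega>"]) (auto intro!: continuous_intros)
      then show ?thesis using False by (simp add: Y_def)
    qed
  qed
  moreover have "AE \<omega> in M. \<forall>s\<ge>0. Y s \<omega> = X s \<omega>"
    using AE_not_in[OF N(1)] by eventually_elim (simp add: Y_def)
  ultimately show ?thesis by blast
qed

text \<open>By Tonelli the expected time spent in a null set vanishes, as \<open>X s\<close> has a density for \<open>s > 0\<close>.
  This makes the path functional depend, almost surely, only on the almost-everywhere class of
  the potential.\<close>

lemma AE_path_avoids_null_set:
  assumes N: "N \<in> null_sets lborel"
  shows "AE \<omega> in M. AE s in lborel. 0 \<le> s \<longrightarrow> X s \<omega> \<notin> N"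
proof -
  obtain Y :: "real \<Rightarrow> 'w \<Rightarrow> real ^ 'n" where
    Y[measurable]: "(\<lambda>(s, \<omega>). Y s \<omega>) \<in> borel_measurable (lborel \<Otimes>\<^sub>M M)"
    and YX: "AE \<omega> in M. \<forall>s\<ge>0. Y s \<omega> = X s \<omega>"
    using ex_jointly_measurable_version by blast
  interpret P: pair_sigma_finite lborel M ..
  have [measurable]: "N \<in> sets borel" using N by auto
  have [measurable]: "(\<lambda>p. Y (fst p) (snd p)) \<in> borel_measurable (lborel \<Otimes>\<^sub>M M)"
    using Y by (simp add: case_prod_beta')
  have avoid: "{p \<in> space (lborel \<Otimes>\<^sub>M M). 0 \<le> fst p \<longrightarrow> Y (fst p) (snd p) \<notin> N} \<in> sets (lborel \<Otimes>\<^sub>M M)"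
    by measurable
  have "AE s in lborel. AE \<omega> in M. 0 \<le> s \<longrightarrow> Y s \<omega> \<notin> N"
    using AE_lborel_singleton[of "0 :: real"]
  proof eventually_elim
    case (elim s)
    show ?case
    proof (cases "0 < s")
      case True
      have [measurable]: "X s \<in> borel_measurable M"
        using random_variable_at True by simp
      have "(\<integral>\<^sup>+\<omega>. indicator N (X s \<omega>) \<partial>M) \<le> 0"
        using nn_integral_position_le[OF True, of "indicator N"] N by (simp add: null_sets_def)
      then have "AE \<omega> in M. indicator N (X s \<omega>) = (0 :: ennreal)"
        by (simp add: nn_integral_0_iff_AE)
      with YX show ?thesis
        by eventually_elim (auto simp: indicator_def split: if_splits)
    qed (use elim in auto)
  qed
  then have "AE \<omega> in M. AE s in lborel. 0 \<le> s \<longrightarrow> Y s \<omega> \<notin> N"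
    by (subst (asm) P.AE_commute[OF avoid])
  with YX show ?thesis
    by eventually_elim auto
qed

text \<open>The hypothesis bounds the expected integral over all of \<open>[0, \<infinity>)\<close>, so that the lower bound is the
  same for every \<open>t\<close>; this uniformity is what makes the time integral of the semigroup diverge.\<close>

lemma exp_neg_additive_functional_ge:
  fixes V W :: "real ^ 'n \<Rightarrow> real"
  assumes W[measurable]: "W \<in> borel_measurable borel"
    and VW: "AE y in lborel. V y = W y"
    and C: "(\<integral>\<^sup>+s. (\<integral>\<^sup>+\<omega>. ennreal (W (X s \<omega>)) \<partial>M) * indicator {0..} s \<partial>lborel) \<le> ennreal C" "C \<ge> 0"
  shows "exp (- C)
    \<le> (\<integral>\<omega>. exp_neg (\<integral>\<^sup>+s\<in>{0..t}. ennreal (V (X s \<omega>)) \<partial>lebesgue) \<partial>completion M)"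
proof -
  obtain Y :: "real \<Rightarrow> 'w \<Rightarrow> real ^ 'n" where
    Y[measurable]: "(\<lambda>(s, \<omega>). Y s \<omega>) \<in> borel_measurable (lborel \<Otimes>\<^sub>M M)"
    and YX: "AE \<omega> in M. \<forall>s\<ge>0. Y s \<omega> = X s \<omega>"
    using ex_jointly_measurable_version by blast
  interpret P: pair_sigma_finite lborel M ..
  from VW obtain N where N: "N \<in> null_sets lborel" "{y. V y \<noteq> W y} \<subseteq> N"
    by (auto simp: eventually_ae_filter)
  have off_N: "V y = W y" if "y \<notin> N" for y using N(2) that by blast
  define Z where "Z \<omega> = (\<integral>\<^sup>+s. ennreal (W (Y s \<omega>)) * indicator {0..t} s \<partial>lborel)" for \<omega>
  have Z_measurable[measurable]: "Z \<in> borel_measurable M"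
    unfolding Z_def[abs_def] by measurable
  have ZV: "AE \<omega> in M. (\<integral>\<^sup>+s\<in>{0..t}. ennreal (V (X s \<omega>)) \<partial>lebesgue) = Z \<omega>"
    using YX AE_path_avoids_null_set[OF N(1)]
  proof eventually_elim
    case (elim \<omega>)
    have "(\<integral>\<^sup>+s. ennreal (V (X s \<omega>)) * indicator {0..t} s \<partial>lborel) = Z \<omega>"
      unfolding Z_def
    proof (rule nn_integral_cong_AE)
      show "AE s in lborel. ennreal (V (X s \<omega>)) * indicator {0..t} s
              = ennreal (W (Y s \<omega>)) * indicator {0..t} s"
        using elim(2)
      proof eventually_elim
        case (elim s)
        then show ?case
          using \<open>\<forall>s\<ge>0. Y s \<omega> = X s \<omega>\<close> off_N by (cases "s \<in> {0..t}") auto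
      qed
    qed
    then show ?case by (simp add: nn_integral_completion)
  qed
  have "(\<integral>\<^sup>+\<omega>. Z \<omega> \<partial>M)
      = (\<integral>\<^sup>+s. (\<integral>\<^sup>+\<omega>. ennreal (W (Y s \<omega>)) * indicator {0..t} s \<partial>M) \<partial>lborel)"
    unfolding Z_def by (rule P.Fubini') measurable
  also have "\<dots> \<le> (\<integral>\<^sup>+s. (\<integral>\<^sup>+\<omega>. ennreal (W (X s \<omega>)) \<partial>M) * indicator {0..} s \<partial>lborel)"
  proof (rule nn_integral_mono)
    fix s :: real
    show "(\<integral>\<^sup>+\<omega>. ennreal (W (Y s \<omega>)) * indicator {0..t} s \<partial>M)
            \<le> (\<integral>\<^sup>+\<omega>. ennreal (W (X s \<omega>)) \<partial>M) * indicator {0..} s"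
    proof (cases "s \<in> {0..t}")
      case True
      then have "(\<integral>\<^sup>+\<omega>. ennreal (W (Y s \<omega>)) \<partial>M) = (\<integral>\<^sup>+\<omega>. ennreal (W (X s \<omega>)) \<partial>M)"
        by (intro nn_integral_cong_AE) (use YX in eventually_elim, auto)
      then show ?thesis using True by simp
    qed simp
  qed
  also have "\<dots> \<le> ennreal C" by (rule C)
  finally have "exp (- C) \<le> (\<integral>\<omega>. exp_neg (Z \<omega>) \<partial>M)"
    by (intro exp_neg_Jensen) (use C in auto)
  also have "\<dots> = (\<integral>\<omega>. exp_neg (Z \<omega>) \<partial>completion M)"
    by (rule integral_completion[symmetric]) measurable
  also have "\<dots> = (\<integral>\<omega>. exp_neg (\<integral>\<^sup>+s\<in>{0..t}. ennreal (V (X s \<omega>)) \<partial>lebesgue) \<partial>completion M)"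
  proof (rule integral_cong_AE)
    show meas: "(\<lambda>\<omega>. exp_neg (Z \<omega>)) \<in> borel_measurable (completion M)"
      by (rule measurable_completion) measurable
    show eq: "AE \<omega> in completion M. exp_neg (Z \<omega>)
        = exp_neg (\<integral>\<^sup>+s\<in>{0..t}. ennreal (V (X s \<omega>)) \<partial>lebesgue)"
      using AE_completion[OF ZV] by eventually_elim simp
    show "(\<lambda>\<omega>. exp_neg (\<integral>\<^sup>+s\<in>{0..t}. ennreal (V (X s \<omega>)) \<partial>lebesgue))
        \<in> borel_measurable (completion M)"
      by (rule borel_measurable_completion_cong_AE[OF measurable_compose[OF Z_measurable exp_neg_measurable]])
        (use ZV in eventually_elim, simp)
  qed
  finally show ?thesis .
qed

end

section \<open>Divergence of the Riesz transform\<close>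

theorem proposition3p2:
  fixes M :: "real ^ 'n \<Rightarrow> 'w measure"
    and X :: "real ^ 'n \<Rightarrow> real \<Rightarrow> 'w \<Rightarrow> real ^ 'n"
    and V :: "real ^ 'n \<Rightarrow> real"
    and q a :: real
  assumes dim: "CARD('n) \<ge> 3"
    and bm: "\<And>x. brownian_motion (M x) (X x) x"
    and V_nonneg: "\<And>x. V x \<ge> 0"
    and V_compact_support: "\<exists>K. compact K \<and> (AE x in lebesgue. x \<notin> K \<longrightarrow> V x = 0)"
    and V_nonzero: "\<not> (AE x in lebesgue. V x = 0)"
    and V_Lq: "mem_Lq q V"
    and q_gt: "q > real CARD('n) / 2"
    and q_ge: "q \<ge> 2"
    and a_pos: "a > 0"
  shows "(\<forall>x. V x \<noteq> 0 \<longrightarrow> riesz_one M X V a x = \<infinity>) \<and> \<not> riesz_bounded_on_Linf M X V a"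
proof -
  obtain K where K: "compact K" "AE x in lebesgue. x \<notin> K \<longrightarrow> V x = 0"
    using V_compact_support by blast
  have "V \<in> borel_measurable lebesgue"
    using V_Lq by (simp add: mem_Lq_def)
  then obtain W0 where W0[measurable]: "W0 \<in> borel_measurable lborel" "AE x in lborel. V x = W0 x"
    using completion_ex_borel_measurable_real by blast
  define W where "W x = max 0 (W0 x)" for x
  have W[measurable]: "W \<in> borel_measurable borel"
    using W0(1) unfolding W_def[abs_def] by simp
  have VW: "AE x in lborel. V x = W x"
    using W0(2)
  proof eventually_elim
    case (elim y)
    then show ?case using V_nonneg[of y] by (simp add: W_def)
  qed
  have W_nonneg: "0 \<le> W x" for x by (simp add: W_def)
  have Lq: "(\<integral>\<^sup>+y. ennreal (W y powr q) \<partial>lborel) < \<infinity>"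
  proof -
    have "(\<integral>\<^sup>+y. ennreal (W y powr q) \<partial>lborel) = (\<integral>\<^sup>+y. ennreal (norm (\<bar>V y\<bar> powr q)) \<partial>lborel)"
      by (rule nn_integral_cong_AE) (use VW in eventually_elim, simp add: W_nonneg)
    also have "\<dots> = (\<integral>\<^sup>+y. ennreal (norm (\<bar>V y\<bar> powr q)) \<partial>lebesgue)"
      by (simp add: nn_integral_completion)
    also have "\<dots> < \<infinity>"
      using V_Lq by (auto simp: mem_Lq_def integrable_iff_bounded)
    finally show ?thesis .
  qed
  have L1: "(\<integral>\<^sup>+y. ennreal (W y) \<partial>lborel) < \<infinity>"
  proof -
    \<comment> \<open>Compact support turns \<open>L\<^sup>q\<close> into \<open>L\<^sup>1\<close>: \<open>W \<le> 1 + W\<^sup>q\<close> on \<open>K\<close>, and \<open>W = 0\<close> almost everywhere else.\<close>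
    have [measurable]: "K \<in> sets borel" using K by (simp add: borel_compact)
    have "(\<integral>\<^sup>+y. ennreal (W y) \<partial>lborel)
        \<le> (\<integral>\<^sup>+y. indicator K y + ennreal (W y powr q) \<partial>lborel)"
    proof (rule nn_integral_mono_AE)
      show "AE y in lborel. ennreal (W y) \<le> indicator K y + ennreal (W y powr q)"
        using VW K(2)[unfolded AE_completion_iff]
      proof eventually_elim
        case (elim y)
        show ?case
        proof (cases "y \<in> K")
          case True
          have "W y \<le> 1 + W y powr q"
          proof (cases "W y \<le> 1")
            case False
            then have "W y powr 1 \<le> W y powr q"
              using q_ge by (intro powr_mono) auto
            then show ?thesis using False by simp
          qed (simp add: add_increasing2)
          then have "ennreal (W y) \<le> ennreal (1 + W y powr q)" by (rule ennreal_leI)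
          then show ?thesis using True by simp
        qed (use elim in simp)
      qed
    qed
    also have "\<dots> = emeasure lborel K + (\<integral>\<^sup>+y. ennreal (W y powr q) \<partial>lborel)"
      by (simp add: nn_integral_add)
    also have "\<dots> < \<infinity>"
      using emeasure_compact_finite[OF K(1)] Lq by simp
    finally show ?thesis .
  qed
  have infinite: "riesz_one M X V a x = \<infinity>" if Vx: "V x \<noteq> 0" for x
  proof -
    interpret brownian_motion "M x" "X x" x by (rule bm)
    have "(\<integral>\<^sup>+s. (\<integral>\<^sup>+\<omega>. ennreal (W (X x s \<omega>)) \<partial>M x) * indicator {0..} s \<partial>lborel) < \<infinity>"
      by (rule expected_occupation_finite[OF dim W W_nonneg q_gt L1 Lq])
    then obtain C where C: "C \<ge> 0"
      "(\<integral>\<^sup>+s. (\<integral>\<^sup>+\<omega>. ennreal (W (X x s \<omega>)) \<partial>M x) * indicator {0..} s \<partial>lborel) = ennreal C"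
      by (cases "\<integral>\<^sup>+s. (\<integral>\<^sup>+\<omega>. ennreal (W (X x s \<omega>)) \<partial>M x) * indicator {0..} s \<partial>lborel") auto
    have lower: "exp (- C) \<le> semigroup M X V t (\<lambda>_. 1) x" for t
      using exp_neg_additive_functional_ge[OF W VW _ C(1), of t] C(2)
      by (simp add: semigroup_def)
    have "\<infinity> = ennreal (exp (- C)) * (\<integral>\<^sup>+t. ennreal (t powr (a - 1)) * indicator {0<..} t \<partial>lborel)"
      using nn_integral_powr_diverges[OF a_pos] by (simp add: ennreal_mult_top)
    also have "\<dots> = (\<integral>\<^sup>+t. ennreal (exp (- C)) * (ennreal (t powr (a - 1)) * indicator {0<..} t) \<partial>lborel)"
      by (rule nn_integral_cmult[symmetric]) measurable
    also have "\<dots> \<le> (\<integral>\<^sup>+t\<in>{0<..}. ennreal (semigroup M X V t (\<lambda>_. 1) x * t powr (a - 1)) \<partial>lborel)"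
    proof (rule nn_integral_mono)
      fix t :: real
      have "ennreal (exp (- C) * t powr (a - 1)) \<le> ennreal (semigroup M X V t (\<lambda>_. 1) x * t powr (a - 1))"
        by (intro ennreal_leI mult_right_mono lower) simp
      then show "ennreal (exp (- C)) * (ennreal (t powr (a - 1)) * indicator {0<..} t)
          \<le> ennreal (semigroup M X V t (\<lambda>_. 1) x * t powr (a - 1)) * indicator {0<..} t"
        by (simp add: indicator_def ennreal_mult)
    qed
    finally have "(\<integral>\<^sup>+t\<in>{0<..}. ennreal (semigroup M X V t (\<lambda>_. 1) x * t powr (a - 1)) \<partial>lebesgue) = \<infinity>"
      by (simp add: nn_integral_completion top_unique)
    moreover have "V x powr a > 0" "1 / Gamma a > 0"
      using Vx V_nonneg[of x] a_pos by (auto simp: Gamma_real_pos)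
    ultimately show ?thesis
      unfolding riesz_one_def by (simp add: ennreal_mult_top)
  qed
  moreover have "\<not> riesz_bounded_on_Linf M X V a"
  proof
    assume "riesz_bounded_on_Linf M X V a"
    then obtain C where C: "AE x in lebesgue. riesz_one M X V a x \<le> C" "C < \<infinity>"
      by (auto simp: riesz_bounded_on_Linf_def Linf_norm_def Inf_less_iff)
    from C(1) have "AE x in lebesgue. V x = 0"
    proof eventually_elim
      case (elim x)
      then show ?case using infinite[of x] C(2) by (cases "V x = 0") (auto simp: top_unique)
    qed
    with V_nonzero show False by simp
  qed
  ultimately show ?thesis by blast
qed

end
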